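(* Let $m>n$ be positive integers and let $A(f)=\langle f,z^n\rangle z^m$ be a rank one operator on $H^2(\mathbb{D})$. Then the Berezin range of $A$, $\mathrm{Ber}(A)$, is a disc with centre at the origin and radius $$\left(\frac{2}{m+n+2}\right)\left(\frac{m+n}{m+n+2}\right)^{\frac{m+n}{2}},$$ and therefore is convex in $\mathbb{C}$.
   Context: $\mathbb{D}$ is the open unit disc in $\mathbb{C}$. $H^2(\mathbb{D})$ is the Hardy space of holomorphic functions $f(z)=\sum_{j\ge 0}a_jz^j$ on $\mathbb{D}$ with $\sum_{j\ge0}|a_j|^2<\infty$, with inner product $\langle f,g\rangle=\sum_{j\ge0}a_j\overline{b_j}$ for $g(z)=\sum_{j\ge 0} b_jz^j$. It is a reproducing kernel Hilbert space with reproducing kernel $k_\lambda(z)=\frac{1}{1-\bar\lambda z}$ at $\lambda\in\mathbb{D}$, and $\hat{k}_\lambda=k_\lambda/\|k_\lambda\|$ is the normalized reproducing kernel. $z^n$ denotes the function $z\mapsto z^n$. For a bounded linear operator $T$ on $H^2(\mathbb{D})$, the Berezin transform is $\widetilde{T}(\lambda)=\langle T\hat{k}_\lambda,\hat{k}_\lambda\rangle$ for $\lambda\in\mathbb{D}$, and the Berezin range is $\mathrm{Ber}(T)=\{\widetilde{T}(\lambda):\lambda\in\mathbb{D}\}$. *)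

theory Defs
  imports "HOL-Complex_Analysis.Complex_Analysis"
begin

(* Elements of H^2 are represented by functions complex => complex of which only the values on
   the open unit disc matter: every notion below depends on a function only through its
   restriction to the disc. *)

definition unit_disc :: "complex set" where
  "unit_disc = ball 0 1"

definition hardy_coeff :: "(complex \<Rightarrow> complex) \<Rightarrow> nat \<Rightarrow> complex" where
  "hardy_coeff f j = fps_nth (fps_expansion f 0) j"

definition hardy_space :: "(complex \<Rightarrow> complex) set" where
  "hardy_space = {f. f holomorphic_on unit_disc \<and> summable (\<lambda>j. (cmod (hardy_coeff f j))\<^sup>2)}"

definition hardy_inner :: "(complex \<Rightarrow> complex) \<Rightarrow> (complex \<Rightarrow> complex) \<Rightarrow> complex" where
  "hardy_inner f g = (\<Sum>j. hardy_coeff f j * cnj (hardy_coeff g j))"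

definition hardy_norm :: "(complex \<Rightarrow> complex) \<Rightarrow> real" where
  "hardy_norm f = sqrt (Re (hardy_inner f f))"

definition bounded_hardy_operator :: "((complex \<Rightarrow> complex) \<Rightarrow> (complex \<Rightarrow> complex)) \<Rightarrow> bool" where
  "bounded_hardy_operator T \<longleftrightarrow>
     (\<forall>f\<in>hardy_space. T f \<in> hardy_space) \<and>
     (\<forall>f\<in>hardy_space. \<forall>g\<in>hardy_space. \<forall>a b. \<forall>z\<in>unit_disc.
        T (\<lambda>w. a * f w + b * g w) z = a * T f z + b * T g z) \<and>
     (\<exists>C. \<forall>f\<in>hardy_space. hardy_norm (T f) \<le> C * hardy_norm f)"

definition hardy_kernel :: "complex \<Rightarrow> complex \<Rightarrow> complex" where
  "hardy_kernel l z = 1 / (1 - cnj l * z)"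

definition normalized_hardy_kernel :: "complex \<Rightarrow> complex \<Rightarrow> complex" where
  "normalized_hardy_kernel l z = hardy_kernel l z / of_real (hardy_norm (hardy_kernel l))"

definition berezin_transform ::
  "((complex \<Rightarrow> complex) \<Rightarrow> (complex \<Rightarrow> complex)) \<Rightarrow> complex \<Rightarrow> complex" where
  "berezin_transform T l =
     hardy_inner (T (normalized_hardy_kernel l)) (normalized_hardy_kernel l)"

definition berezin_range :: "((complex \<Rightarrow> complex) \<Rightarrow> (complex \<Rightarrow> complex)) \<Rightarrow> complex set" where
  "berezin_range T = berezin_transform T ` unit_disc"

lemma hardy_coeff_eqI: "f has_fps_expansion F \<Longrightarrow> hardy_coeff f j = fps_nth F j"
  unfolding hardy_coeff_def fps_expansion_def by (simp add: fps_nth_fps_expansion)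

lemma hardy_coeff_cong:
  assumes "\<And>z. z \<in> unit_disc \<Longrightarrow> f z = g z"
  shows "hardy_coeff f = hardy_coeff g"
proof -
  have "eventually (\<lambda>z. f z = g z) (nhds 0)"
    using assms by (intro eventually_nhds_in_open[of unit_disc, THEN eventually_mono])
                   (auto simp: unit_disc_def)
  then show ?thesis
    unfolding hardy_coeff_def fps_expansion_def by (auto simp: fun_eq_iff intro!: higher_deriv_cong_ev)
qed

lemma hardy_has_fps_expansion:
  assumes "f \<in> hardy_space"
  shows "f has_fps_expansion fps_expansion f 0"
  using assms unfolding hardy_space_def unit_disc_def
  by (intro has_fps_expansion_fps_expansion[of "ball 0 1"]) auto

lemma hardy_coeff_monom: "hardy_coeff (\<lambda>z. c * z ^ n) j = (if j = n then c else 0)"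
proof -
  have "(\<lambda>z::complex. c * z ^ n) has_fps_expansion fps_const c * fps_X ^ n"
    by (intro fps_expansion_intros)
  from hardy_coeff_eqI[OF this] show ?thesis by simp
qed

lemma hardy_inner_monom: "hardy_inner f (\<lambda>z. z ^ n) = hardy_coeff f n"
proof -
  have "hardy_inner f (\<lambda>z. 1 * z ^ n) = hardy_coeff f n"
    unfolding hardy_inner_def hardy_coeff_monom
    by (subst suminf_finite[of "{n}"]) auto
  then show ?thesis by simp
qed

lemma hardy_norm_eq:
  assumes "summable (\<lambda>j. (cmod (hardy_coeff f j))\<^sup>2)"
  shows "hardy_norm f = sqrt (\<Sum>j. (cmod (hardy_coeff f j))\<^sup>2)"
proof -
  have "hardy_inner f f = of_real (\<Sum>j. (cmod (hardy_coeff f j))\<^sup>2)"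
    unfolding hardy_inner_def using assms by (simp add: complex_norm_square[symmetric] suminf_of_real)
  then show ?thesis unfolding hardy_norm_def by simp
qed

lemma bounded_hardy_operator_rank_one:
  assumes A: "\<And>f z. f \<in> hardy_space \<Longrightarrow> z \<in> unit_disc \<Longrightarrow>
                A f z = hardy_inner f (\<lambda>w. w ^ n) * z ^ m"
  shows "bounded_hardy_operator A"
proof -
  have co: "hardy_coeff (A f) = (\<lambda>j. if j = m then hardy_coeff f n else 0)"
    if "f \<in> hardy_space" for f
  proof -
    have "hardy_coeff (A f) = hardy_coeff (\<lambda>z. hardy_coeff f n * z ^ m)"
      using A[OF that] by (intro hardy_coeff_cong) (simp add: hardy_inner_monom)
    then show ?thesis by (auto simp: hardy_coeff_monom)
  qed
  have su: "(\<lambda>j. (cmod (hardy_coeff (A f) j))\<^sup>2) sums (cmod (hardy_coeff f n))\<^sup>2"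
    if "f \<in> hardy_space" for f
    using sums_single[of m "\<lambda>_. (cmod (hardy_coeff f n))\<^sup>2"] co[OF that]
    by (simp add: if_distrib[of "\<lambda>x. (cmod x)\<^sup>2"] cong: if_cong)
  have 1: "A f \<in> hardy_space" if f: "f \<in> hardy_space" for f
  proof -
    have "(\<lambda>z. hardy_inner f (\<lambda>w. w ^ n) * z ^ m) holomorphic_on unit_disc"
      by (intro holomorphic_intros)
    then have "A f holomorphic_on unit_disc"
      using A[OF f] by (simp cong: holomorphic_cong)
    then show ?thesis using su[OF f] by (auto simp: hardy_space_def sums_iff)
  qed
  have 2: "A (\<lambda>w. a * f w + b * g w) z = a * A f z + b * A g z"
    if f: "f \<in> hardy_space" and g: "g \<in> hardy_space" and z: "z \<in> unit_disc" for f g a b z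
  proof -
    let ?h = "\<lambda>w. a * f w + b * g w"
    have lin: "hardy_coeff ?h j = a * hardy_coeff f j + b * hardy_coeff g j" for j
    proof -
      have "?h has_fps_expansion
              fps_const a * fps_expansion f 0 + fps_const b * fps_expansion g 0"
        by (intro fps_expansion_intros hardy_has_fps_expansion f g)
      from hardy_coeff_eqI[OF this] show ?thesis by (simp add: hardy_coeff_def)
    qed
    have "?h \<in> hardy_space"
      unfolding hardy_space_def
    proof (safe)
      show "?h holomorphic_on unit_disc"
        using f g by (auto simp: hardy_space_def intro!: holomorphic_intros)
      show "summable (\<lambda>j. (cmod (hardy_coeff ?h j))\<^sup>2)"
      proof (rule summable_comparison_test)
        show "summable (\<lambda>j. 2 * (cmod a)\<^sup>2 * (cmod (hardy_coeff f j))\<^sup>2 +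
                              2 * (cmod b)\<^sup>2 * (cmod (hardy_coeff g j))\<^sup>2)"
          using f g by (intro summable_add summable_mult) (auto simp: hardy_space_def)
        have "(cmod (hardy_coeff ?h j))\<^sup>2 \<le> 2 * (cmod a)\<^sup>2 * (cmod (hardy_coeff f j))\<^sup>2 +
                              2 * (cmod b)\<^sup>2 * (cmod (hardy_coeff g j))\<^sup>2" for j
        proof -
          define x y where "x = cmod (a * hardy_coeff f j)" and "y = cmod (b * hardy_coeff g j)"
          have "cmod (hardy_coeff ?h j) \<le> x + y"
            unfolding lin x_def y_def by (rule norm_triangle_ineq)
          then have "(cmod (hardy_coeff ?h j))\<^sup>2 \<le> (x + y)\<^sup>2"
            by (intro power_mono) auto
          also have "\<dots> \<le> 2 * x\<^sup>2 + 2 * y\<^sup>2"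
            using zero_le_power2[of "x - y"] by (simp add: power2_sum power2_diff)
          finally show ?thesis
            by (simp add: x_def y_def norm_mult power_mult_distrib mult.assoc)
        qed
        then show "\<exists>N. \<forall>j\<ge>N. norm ((cmod (hardy_coeff ?h j))\<^sup>2) \<le>
              2 * (cmod a)\<^sup>2 * (cmod (hardy_coeff f j))\<^sup>2 +
              2 * (cmod b)\<^sup>2 * (cmod (hardy_coeff g j))\<^sup>2"
          by simp
      qed
    qed
    then show ?thesis
      using A f g z by (simp add: hardy_inner_monom lin algebra_simps)
  qed
  have 3: "hardy_norm (A f) \<le> 1 * hardy_norm f" if f: "f \<in> hardy_space" for f
  proof -
    have s: "summable (\<lambda>j. (cmod (hardy_coeff f j))\<^sup>2)"
      using f by (simp add: hardy_space_def)
    have "(cmod (hardy_coeff f n))\<^sup>2 \<le> (\<Sum>j. (cmod (hardy_coeff f j))\<^sup>2)"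
      using sum_le_suminf[OF s, of "{n}"] by simp
    then show ?thesis
      using su[OF f] by (auto simp: hardy_norm_eq s sums_iff intro!: real_le_rsqrt)
  qed
  show ?thesis
    unfolding bounded_hardy_operator_def using 1 2 3 by blast
qed

end

theory Submission
  imports Defs
begin

text \<open>
  The Berezin transform of the operator at \<open>\<lambda>\<close> is
  \<open>cnj \<lambda> ^ n * \<lambda> ^ m * (1 - \<bar>\<lambda>\<bar>\<^sup>2)\<close>, because the Taylor coefficients of the kernel at
  \<open>\<lambda>\<close> are the powers of \<open>cnj \<lambda>\<close> and its squared norm is \<open>1 / (1 - \<bar>\<lambda>\<bar>\<^sup>2)\<close>. In polar
  coordinates \<open>\<lambda> = r * cis t\<close> this is \<open>r ^ (m + n) * (1 - r\<^sup>2)\<close> with phase \<open>(m - n) * t\<close>.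
  Since \<open>m \<noteq> n\<close> the phase is arbitrary and independent of the modulus, so the range is a union
  of circles about the origin whose radii are the values of \<open>r ^ (m + n) * (1 - r\<^sup>2)\<close> on
  \<open>[0, 1)\<close>. That function vanishes at \<open>0\<close> and attains its maximum at
  \<open>r\<^sup>2 = (m + n) / (m + n + 2)\<close> (lemma \<open>powr_mult_one_minus_le\<close> with \<open>a = (m + n) / 2\<close>);
  by the intermediate value theorem its values fill the whole interval up to the maximum, and
  the circles fill a closed disc.
\<close>

text \<open>
  The scalar factor makes this apply to the kernel and to its normalisation alike.
\<close>

lemma hardy_coeff_scaled_kernel:
  "hardy_coeff (\<lambda>z. c * hardy_kernel l z) j = c * cnj l ^ j"
proof -
  have "(\<lambda>z. c * inverse (1 - cnj l * z)) has_fps_expansion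
          fps_const c * inverse (1 - fps_const (cnj l) * fps_X)"
    by (intro fps_expansion_intros) auto
  also have "inverse (1 - fps_const (cnj l) * fps_X) = Abs_fps (\<lambda>j. cnj l ^ j)"
    using one_minus_const_fps_X_neg_power'[of 1 "cnj l"] by simp
  finally show ?thesis
    by (subst hardy_coeff_eqI) (auto simp: hardy_kernel_def field_simps)
qed

lemma holomorphic_hardy_kernel:
  assumes "l \<in> unit_disc"
  shows "hardy_kernel l holomorphic_on unit_disc"
proof -
  have "1 - cnj l * z \<noteq> 0" if "z \<in> unit_disc" for z
  proof
    assume "1 - cnj l * z = 0"
    then have "cmod l * cmod z = 1"
      by (metis complex_mod_cnj eq_iff_diff_eq_0 norm_mult norm_one)
    moreover have "cmod l * cmod z < 1 * 1"
      using assms that by (intro mult_strict_mono') (auto simp: unit_disc_def)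
    ultimately show False by simp
  qed
  then have "(\<lambda>z. 1 / (1 - cnj l * z)) holomorphic_on unit_disc"
    by (intro holomorphic_intros)
  then show ?thesis by (simp add: hardy_kernel_def[abs_def])
qed

lemma sums_hardy_coeff_scaled_kernel:
  assumes "l \<in> unit_disc"
  shows "(\<lambda>j. (cmod (hardy_coeff (\<lambda>z. c * hardy_kernel l z) j))\<^sup>2)
           sums ((cmod c)\<^sup>2 / (1 - (cmod l)\<^sup>2))"
proof -
  have "(\<lambda>j. (cmod c)\<^sup>2 * ((cmod l)\<^sup>2) ^ j) sums ((cmod c)\<^sup>2 * (1 / (1 - (cmod l)\<^sup>2)))"
    using assms
    by (intro sums_mult geometric_sums) (auto simp: unit_disc_def power_less_one_iff abs_square_less_1)
  then show ?thesis
    by (simp add: hardy_coeff_scaled_kernel norm_mult norm_power power_mult_distrib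
                  power_mult[symmetric] mult.commute)
qed

lemma hardy_norm_kernel_power2:
  assumes "l \<in> unit_disc"
  shows "(hardy_norm (hardy_kernel l))\<^sup>2 = 1 / (1 - (cmod l)\<^sup>2)"
proof -
  have s: "(\<lambda>j. (cmod (hardy_coeff (hardy_kernel l) j))\<^sup>2) sums (1 / (1 - (cmod l)\<^sup>2))"
    using sums_hardy_coeff_scaled_kernel[OF assms, of 1] by simp
  have "(cmod l)\<^sup>2 < 1"
    using assms by (simp add: unit_disc_def abs_square_less_1)
  then show ?thesis
    using s by (simp add: hardy_norm_eq sums_iff)
qed

lemma normalized_hardy_kernel_altdef:
  "normalized_hardy_kernel l =
     (\<lambda>z. of_real (1 / hardy_norm (hardy_kernel l)) * hardy_kernel l z)"
  by (auto simp: normalized_hardy_kernel_def)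

lemma normalized_hardy_kernel_in_hardy_space:
  assumes "l \<in> unit_disc"
  shows "normalized_hardy_kernel l \<in> hardy_space"
proof -
  have "(\<lambda>z. c * hardy_kernel l z) \<in> hardy_space" for c
    unfolding hardy_space_def
    using sums_hardy_coeff_scaled_kernel[OF assms, of c] holomorphic_hardy_kernel[OF assms]
    by (auto simp: sums_iff intro!: holomorphic_intros)
  then show ?thesis
    unfolding normalized_hardy_kernel_altdef .
qed

text \<open>
  The image of a kernel under the operator is a multiple of one monomial, so the inner product
  that defines the transform reduces to its \<open>m\<close>-th term.
\<close>

lemma berezin_transform_rank_one:
  assumes A: "\<And>f z. f \<in> hardy_space \<Longrightarrow> z \<in> unit_disc \<Longrightarrow>
                A f z = hardy_inner f (\<lambda>w. w ^ n) * z ^ m"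
    and l: "l \<in> unit_disc"
  shows "berezin_transform A l = cnj l ^ n * l ^ m * of_real (1 - (cmod l)\<^sup>2)"
proof -
  let ?k = "normalized_hardy_kernel l"
  define c where "c = 1 / hardy_norm (hardy_kernel l)"
  have coeff: "hardy_coeff ?k j = of_real c * cnj l ^ j" for j
    unfolding normalized_hardy_kernel_altdef c_def by (rule hardy_coeff_scaled_kernel)
  have "hardy_coeff (A ?k) = hardy_coeff (\<lambda>z. hardy_coeff ?k n * z ^ m)"
    using A[OF normalized_hardy_kernel_in_hardy_space[OF l]]
    by (intro hardy_coeff_cong) (simp add: hardy_inner_monom)
  then have "berezin_transform A l = hardy_coeff ?k n * cnj (hardy_coeff ?k m)"
    unfolding berezin_transform_def hardy_inner_def
    by (subst suminf_finite[of "{m}"]) (auto simp: hardy_coeff_monom)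
  also have "\<dots> = cnj l ^ n * l ^ m * of_real (c\<^sup>2)"
    by (simp add: coeff power2_eq_square)
  also have "c\<^sup>2 = 1 - (cmod l)\<^sup>2"
    using hardy_norm_kernel_power2[OF l] by (simp add: c_def power_divide)
  finally show ?thesis .
qed

text \<open>
  The logarithm of the quotient of the two sides is estimated by \<open>ln y \<le> y - 1\<close>, applied to
  \<open>x / x\<^sub>0\<close> and \<open>(1 - x) / (1 - x\<^sub>0)\<close> at the critical point \<open>x\<^sub>0 = a / (a + 1)\<close>; the linear
  bounds cancel exactly, which replaces a derivative test.
\<close>

lemma powr_mult_one_minus_le:
  fixes a x :: real
  assumes "0 < a" and "0 < x" and "x < 1"
  shows "x powr a * (1 - x) \<le> (a / (a + 1)) powr a * (1 / (a + 1))"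
proof -
  define p where "p = a / (a + 1)"
  have p: "0 < p" "1 / (a + 1) = 1 - p" "p < 1"
    using assms by (auto simp: p_def field_simps)
  have "a * ln (x / p) \<le> a * (x / p - 1)"
    using assms p by (intro mult_left_mono ln_le_minus_one) auto
  also have "\<dots> = (a + 1) * x - a"
    using assms by (simp add: p_def field_simps)
  finally have "a * ln (x / p) \<le> (a + 1) * x - a" .
  moreover have "ln ((1 - x) / (1 - p)) \<le> (a + 1) * (1 - x) - 1"
  proof -
    have "ln ((1 - x) / (1 - p)) \<le> (1 - x) / (1 - p) - 1"
      using assms p by (intro ln_le_minus_one) auto
    moreover have "(1 - x) / (1 - p) = (a + 1) * (1 - x)"
      using assms by (simp flip: p(2))
    ultimately show ?thesis by simp
  qed
  ultimately have "a * ln x + ln (1 - x) \<le> a * ln p + ln (1 - p)"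
    using assms p by (simp add: ln_div algebra_simps)
  then have "exp (a * ln x + ln (1 - x)) \<le> exp (a * ln p + ln (1 - p))"
    by simp
  then have "x powr a * (1 - x) \<le> p powr a * (1 - p)"
    using assms p by (simp add: exp_add powr_def)
  then show ?thesis
    by (simp add: p_def[symmetric] p(2))
qed

lemma powr_half_square:
  assumes "0 < (r :: real)"
  shows "(r\<^sup>2) powr (real s / 2) = r ^ s"
proof -
  have "(r\<^sup>2) powr (real s / 2) = (r powr 2) powr (real s / 2)"
    using assms by simp
  also have "\<dots> = r powr real s"
    by (simp only: powr_powr) simp
  also have "\<dots> = r ^ s"
    using assms by (simp add: powr_realpow)
  finally show ?thesis .
qed

text \<open>
  The radii of the circles that make up the Berezin range. Squaring the variable turns the upper
  bound into the optimisation problem of \<open>powr_mult_one_minus_le\<close> with \<open>a = s / 2\<close>.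
\<close>

lemma image_power_mult_one_minus_square:
  assumes "0 < s"
  shows "(\<lambda>r. r ^ s * (1 - r\<^sup>2)) ` {0..<1} =
           {0..2 / (real s + 2) * (real s / (real s + 2)) powr (real s / 2)}"
    (is "?g ` _ = {0..?R}")
proof (intro equalityI subsetI)
  have a: "real s / 2 / (real s / 2 + 1) = real s / (real s + 2)"
          "1 / (real s / 2 + 1) = 2 / (real s + 2)"
    by (simp_all add: field_simps)
  fix y assume "y \<in> ?g ` {0..<1}"
  then obtain r where r: "0 \<le> r" "r < 1" and y: "y = ?g r" by auto
  have r2: "r\<^sup>2 < 1"
    using r by (simp add: abs_square_less_1)
  have "y \<le> ?R"
  proof (cases "r = 0")
    case True
    then show ?thesis using assms y by (simp add: zero_power)
  next
    case False
    then show ?thesis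
      using powr_mult_one_minus_le[of "real s / 2" "r\<^sup>2"] r r2 assms
      unfolding y a by (simp add: powr_half_square mult.commute)
  qed
  moreover have "0 \<le> y" using r r2 y by simp
  ultimately show "y \<in> {0..?R}" by simp
next
  fix y assume y: "y \<in> {0..?R}"
  \<comment> \<open>The square of the maximiser, so that the intermediate value theorem on \<open>[0, sqrt p]\<close> reaches
     every value up to the maximum.\<close>
  define p where "p = real s / (real s + 2)"
  have p: "0 < p" "p < 1" using assms by (auto simp: p_def field_simps)
  have "sqrt p ^ s = p powr (real s / 2)"
    using powr_half_square[of "sqrt p" s] p by simp
  moreover have "1 - p = 2 / (real s + 2)"
    using assms by (simp add: p_def field_simps)
  ultimately have max: "?g (sqrt p) = ?R"
    using p by (simp add: p_def)
  have "\<exists>r\<ge>0. r \<le> sqrt p \<and> ?g r = y"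
  proof (rule IVT')
    show "?g 0 \<le> y" using assms y by (simp add: zero_power)
    show "y \<le> ?g (sqrt p)" using y max by simp
    show "0 \<le> sqrt p" using p by simp
    show "continuous_on {0..sqrt p} ?g" by (intro continuous_intros)
  qed
  then obtain r where r: "0 \<le> r" "r \<le> sqrt p" "?g r = y" by blast
  have "sqrt p < 1" using p by simp
  with r(2) have "r < 1" by (rule le_less_trans)
  with r show "y \<in> ?g ` {0..<1}"
    by (intro image_eqI[of _ _ r]) auto
qed

theorem theorem2p10:
  fixes m n :: nat
    and A :: "(complex \<Rightarrow> complex) \<Rightarrow> (complex \<Rightarrow> complex)"
  assumes "0 < n" and "n < m"
    and "\<And>f z. f \<in> hardy_space \<Longrightarrow> z \<in> unit_disc \<Longrightarrow>
           A f z = hardy_inner f (\<lambda>w. w ^ n) * z ^ m"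
  shows "berezin_range A =
           cball 0 ((2 / (real m + real n + 2)) *
             ((real m + real n) / (real m + real n + 2)) powr ((real m + real n) / 2))
         \<and> convex (berezin_range A)"
proof -
  let ?g = "\<lambda>r::real. r ^ (m + n) * (1 - r\<^sup>2)"
  let ?R = "(2 / (real m + real n + 2)) *
             ((real m + real n) / (real m + real n + 2)) powr ((real m + real n) / 2)"
  have berezin: "berezin_transform A l = cnj l ^ n * l ^ m * of_real (1 - (cmod l)\<^sup>2)"
    if "l \<in> unit_disc" for l
    by (rule berezin_transform_rank_one[OF _ that]) (rule assms(3))
  have radii: "?g ` {0..<1} = {0..?R}"
    using image_power_mult_one_minus_square[of "m + n"] assms(1) by simp
  have "berezin_range A = cball 0 ?R"
  proof (intro equalityI subsetI)
    fix w assume "w \<in> berezin_range A"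
    then obtain l where l: "l \<in> unit_disc" "w = berezin_transform A l"
      by (auto simp: berezin_range_def)
    then have l1: "cmod l < 1" by (simp add: unit_disc_def)
    then have "(cmod l)\<^sup>2 \<le> 1"
      by (simp add: abs_square_le_1)
    then have "cmod w = ?g (cmod l)"
      unfolding l(2) berezin[OF l(1)] norm_mult norm_power norm_of_real
      by (simp add: power_add mult.commute)
    also have "\<dots> \<in> {0..?R}"
      using l1 unfolding radii[symmetric] by auto
    finally show "w \<in> cball 0 ?R" by simp
  next
    fix w :: complex assume "w \<in> cball 0 ?R"
    then have "cmod w \<in> ?g ` {0..<1}"
      unfolding radii by simp
    then obtain r where r: "0 \<le> r" "r < 1" "?g r = cmod w" by auto
    \<comment> \<open>The transform multiplies the argument of its parameter by \<open>m - n\<close>.\<close>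
    define t where "t = Arg w / real (m - n)"
    define l where "l = of_real r * cis t"
    have l: "l \<in> unit_disc" "cmod l = r"
      using r by (simp_all add: l_def unit_disc_def norm_mult)
    have "cis t ^ m = cis t ^ n * cis (Arg w)"
    proof -
      have "cis t ^ m = cis t ^ n * cis t ^ (m - n)"
        using assms(2) by (simp flip: power_add)
      also have "cis t ^ (m - n) = cis (Arg w)"
        using assms(2) by (simp add: Complex.DeMoivre t_def)
      finally show ?thesis .
    qed
    moreover have "cnj (cis t) ^ n * cis t ^ n = 1"
      by (simp flip: power_mult_distrib add: cis_cnj cis_mult)
    ultimately have "cnj (cis t) ^ n * cis t ^ m = cis (Arg w)"
      by (simp flip: mult.assoc)
    then have "cnj l ^ n * l ^ m = of_real (r ^ (m + n)) * cis (Arg w)"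
      by (simp add: l_def power_mult_distrib power_add mult_ac)
    then have "berezin_transform A l = of_real (?g r) * cis (Arg w)"
      unfolding berezin[OF l(1)] l(2) by (simp add: mult_ac)
    also have "\<dots> = w"
      unfolding r(3) by (metis rcis_cmod_Arg rcis_def)
    finally show "w \<in> berezin_range A"
      using l(1) by (auto simp: berezin_range_def)
  qed
  then show ?thesis by simp
qed

end
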